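(* Let $N$ be a finite nonempty set of agents and $\Phi$ a countable set of atomic propositions. For every $\emptyset\neq G\subseteq N$ and all formulas $\varphi,\psi\in\mathcal{L}$, the following formulas are valid (true at every path and every stage of every iCGS over $N,\Phi$): 1. $\models\langle\langle G\rangle\rangle\bigcirc\varphi\leftrightarrow\langle\langle G\rangle\rangle\bigcirc D_G\varphi$; 2. $\models\langle\langle G\rangle\rangle\bigcirc\varphi\leftrightarrow D_G\langle\langle G\rangle\rangle\bigcirc\varphi$; 3. $\models\langle\langle G\rangle\rangle\Box\varphi\leftrightarrow\langle\langle G\rangle\rangle\Box D_G\varphi$; 4. $\models\langle\langle G\rangle\rangle\Box\varphi\leftrightarrow D_G\langle\langle G\rangle\rangle\Box\varphi$; 5. $\models\langle\langle G\rangle\rangle (D_G\varphi)\,\mathcal{U}\,(D_G\psi)\rightarrow\langle\langle G\rangle\rangle\varphi\,\mathcal{U}\,\psi$; 6. $\models\langle\langle G\rangle\rangle\varphi\,\mathcal{U}\,\psi\leftrightarrow D_G\langle\langle G\rangle\rangle\varphi\,\mathcal{U}\,\psi$.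
   Context: Language. $\Phi$ is a countable set of atomic propositions and $N$ a finite nonempty set of agents. The language $\mathcal{L}$ is given by $\varphi := p \mid \neg\varphi \mid \varphi\wedge\varphi \mid \langle\langle G\rangle\rangle\bigcirc\varphi \mid \langle\langle G\rangle\rangle\Box\varphi \mid \langle\langle G\rangle\rangle\varphi\,\mathcal{U}\,\varphi$ with $p\in\Phi$ and $\emptyset\neq G\subseteq N$. Other Boolean connectives are the usual abbreviations. $D_G\varphi$ abbreviates $\langle\langle G\rangle\rangle\varphi\,\mathcal{U}\,\varphi$. Models. An imperfect information concurrent game structure (iCGS) is $M=(N,\Phi,W,\mathcal{A},\pi,d,\delta,\{R_i\}_{i\in N})$ with $N=\{1,\dots,k\}$; $W$ a nonempty finite set of states; $\mathcal{A}$ a nonempty finite set of actions; $\pi:\Phi\to\wp(W)$ a valuation; $d$ assigning to each $i\in N$, $w\in W$ a nonempty set $d_i(w)\subseteq\mathcal{A}$ of available actions, with $D(w)=d_1(w)\times\cdots\times d_k(w)$; $\delta$ a transition function giving $\delta(w,\alpha)\in W$ for each $w\in W$, $\alpha\in D(w)$; each $R_i$ an equivalence relation on $W$ such that $wR_iw'$ implies $d_i(w)=d_i(w')$. Paths and histories. A path $\lambda$ is an infinite sequence $w_0\stackrel{\alpha_1}{\to}w_1\stackrel{\alpha_2}{\to}w_2\cdots$ with $\alpha_j\in D(w_{j-1})$ and $\delta(w_{j-1},\alpha_j)=w_j$ for all $j\ge1$ ($w_0\in W$ arbitrary). $\lambda[j]=w_j$; $\lambda[j,k]$ is the segment from the $j$-th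 to the $k$-th state (including actions). A history is a finite segment of a path; $H$ is the set of histories, $|h|$ is the number of actions in $h$, and $last(h)$ its last state. $\alpha(i)$ is the $i$-th component of $\alpha$, and $\theta_i(\lambda,j)=\alpha_{j+1}(i)$ is the action of $i$ taken at stage $j$ on $\lambda$. Indistinguishability. Histories $h=w_0\stackrel{\alpha_1}{\to}\cdots\stackrel{\alpha_m}{\to}w_m$ and $h'=w'_0\stackrel{\alpha'_1}{\to}\cdots\stackrel{\alpha'_n}{\to}w'_n$ satisfy $h\approx_i h'$ iff $m=n$, $w_jR_iw'_j$ for all $0\le j\le m$, and $\alpha_l(i)=\alpha'_l(i)$ for all $1\le l\le m$. For $G\neq\emptyset$, $\approx_G=\bigcap_{i\in G}\approx_i$. For paths, $\lambda\approx_G^j\lambda'$ iff $\lambda[0,j]\approx_G\lambda'[0,j]$, and $\approx_G^j(\lambda)=\{\lambda' : \lambda\approx_G^j\lambda'\}$. Strategies. For $i\in G$, a (uniform perfect recall) strategy for $i$ w.r.t. $G$ is $f_i:H\to\mathcal{A}$ with $f_i(h)\in d_i(last(h))$ for all $h$, and $f_i(h)=f_i(h')$ whenever $h\approx_G h'$. A joint strategy $F_G=\langle f_i\rangle_{i\in G}$ consists of one such strategy for each $i\in G$. $\mathcal{P}(h,f_i)$ is the set of paths $\lambda$ with $\lambda[0,|h|]=h$ and $f_i(\lambda[0,j])=\theta_i(\lambda,j)$ for all $j\ge|h|$; $\mathcal{P}(h,F_G)=\bigcap_{i\in G}\mathcal{P}(h,f_i)$. Satisfaction at path $\lambda$ and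 stage $j\in\mathbb{N}$. $M,\lambda,j\models p$ iff $\lambda[j]\in\pi(p)$; $\neg,\wedge$ as usual; - $M,\lambda,j\models\langle\langle G\rangle\rangle\bigcirc\varphi$ iff there is $F_G$ such that for all $\lambda'\in\approx_G^j(\lambda)$ and all $\lambda''\in\mathcal{P}(\lambda'[0,j],F_G)$: $M,\lambda'',j+1\models\varphi$; - $M,\lambda,j\models\langle\langle G\rangle\rangle\Box\varphi$ iff there is $F_G$ such that for all such $\lambda',\lambda''$ and all $k\ge j$: $M,\lambda'',k\models\varphi$; - $M,\lambda,j\models\langle\langle G\rangle\rangle\varphi_1\,\mathcal{U}\,\varphi_2$ iff there is $F_G$ such that for all such $\lambda',\lambda''$ there is $k\ge j$ with $M,\lambda'',k\models\varphi_2$ and $M,\lambda'',t\models\varphi_1$ for all $j\le t<k$. $\varphi$ is valid, $\models\varphi$, iff $M,\lambda,j\models\varphi$ for every iCGS $M$, path $\lambda$ of $M$ and stage $j\in\mathbb{N}$. *)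

theory Defs
  imports Main "HOL-Library.Countable"
begin

text \<open>The agents are the elements of a type \<open>'ag\<close> and the atomic propositions those of a type
  \<open>'p\<close>; \<open>'ag\<close> is later taken of class \<open>finite\<close> and \<open>'p\<close> of class \<open>countable\<close>. The datatype
  also contains formulas with empty coalitions; \<open>language\<close> carves out the proper ones.\<close>

datatype ('ag, 'p) formula =
    Atom 'p
  | Neg "('ag, 'p) formula"
  | Conj "('ag, 'p) formula" "('ag, 'p) formula"
  | CNext "'ag set" "('ag, 'p) formula"
  | CAlways "'ag set" "('ag, 'p) formula"
  | CUntil "'ag set" "('ag, 'p) formula" "('ag, 'p) formula"

inductive_set language :: "('ag, 'p) formula set" where
  "Atom p \<in> language"
| "\<phi> \<in> language \<Longrightarrow> Neg \<phi> \<in> language"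
| "\<phi> \<in> language \<Longrightarrow> \<psi> \<in> language \<Longrightarrow> Conj \<phi> \<psi> \<in> language"
| "G \<noteq> {} \<Longrightarrow> \<phi> \<in> language \<Longrightarrow> CNext G \<phi> \<in> language"
| "G \<noteq> {} \<Longrightarrow> \<phi> \<in> language \<Longrightarrow> CAlways G \<phi> \<in> language"
| "G \<noteq> {} \<Longrightarrow> \<phi> \<in> language \<Longrightarrow> \<psi> \<in> language \<Longrightarrow> CUntil G \<phi> \<psi> \<in> language"

abbreviation Imp :: "('ag, 'p) formula \<Rightarrow> ('ag, 'p) formula \<Rightarrow> ('ag, 'p) formula" where
  "Imp \<phi> \<psi> \<equiv> Neg (Conj \<phi> (Neg \<psi>))"

abbreviation Iff :: "('ag, 'p) formula \<Rightarrow> ('ag, 'p) formula \<Rightarrow> ('ag, 'p) formula" where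
  "Iff \<phi> \<psi> \<equiv> Conj (Imp \<phi> \<psi>) (Imp \<psi> \<phi>)"

abbreviation DK :: "'ag set \<Rightarrow> ('ag, 'p) formula \<Rightarrow> ('ag, 'p) formula" where
  "DK G \<phi> \<equiv> CUntil G \<phi> \<phi>"

text \<open>A joint action is a function from agents to actions.\<close>

record ('ag, 'p, 'w, 'a) game_structure =
  states :: "'w set"
  actions :: "'a set"
  val :: "'p \<Rightarrow> 'w set"
  avail :: "'ag \<Rightarrow> 'w \<Rightarrow> 'a set"
  trans :: "'w \<Rightarrow> ('ag \<Rightarrow> 'a) \<Rightarrow> 'w"
  indist :: "'ag \<Rightarrow> ('w \<times> 'w) set"

definition joint_avail :: "('ag, 'p, 'w, 'a) game_structure \<Rightarrow> 'w \<Rightarrow> ('ag \<Rightarrow> 'a) set" where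
  "joint_avail M w = {\<alpha>. \<forall>i. \<alpha> i \<in> avail M i w}"

definition icgs :: "('ag, 'p, 'w, 'a) game_structure \<Rightarrow> bool" where
  "icgs M \<longleftrightarrow>
     states M \<noteq> {} \<and> finite (states M) \<and>
     actions M \<noteq> {} \<and> finite (actions M) \<and>
     (\<forall>p. val M p \<subseteq> states M) \<and>
     (\<forall>i. \<forall>w\<in>states M. avail M i w \<noteq> {} \<and> avail M i w \<subseteq> actions M) \<and>
     (\<forall>w\<in>states M. \<forall>\<alpha>\<in>joint_avail M w. trans M w \<alpha> \<in> states M) \<and>
     (\<forall>i. equiv (states M) (indist M i)) \<and>
     (\<forall>i w w'. (w, w') \<in> indist M i \<longrightarrow> avail M i w = avail M i w')"

text \<open>\<open>pacts l j\<close> is the joint action leading from the \<open>j\<close>-th to the \<open>(j+1)\<close>-st state, written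
  \<open>\<alpha>\<close> with index \<open>j + 1\<close> in the usual notation; so \<open>pacts l j i\<close> is the action taken by agent
  \<open>i\<close> at stage \<open>j\<close>. Likewise a history with \<open>n\<close> actions has the states \<open>hstates h ! 0\<close> to
  \<open>hstates h ! n\<close> and the joint actions \<open>hacts h ! 0\<close> to \<open>hacts h ! (n - 1)\<close>.\<close>

datatype ('ag, 'w, 'a) path =
  Path (pstates: "nat \<Rightarrow> 'w") (pacts: "nat \<Rightarrow> 'ag \<Rightarrow> 'a")

datatype ('ag, 'w, 'a) history =
  History (hstates: "'w list") (hacts: "('ag \<Rightarrow> 'a) list")

definition paths :: "('ag, 'p, 'w, 'a) game_structure \<Rightarrow> ('ag, 'w, 'a) path set" where
  "paths M = {l. \<forall>j. pstates l j \<in> states M \<and>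
                     pacts l j \<in> joint_avail M (pstates l j) \<and>
                     trans M (pstates l j) (pacts l j) = pstates l (Suc j)}"

definition segment :: "('ag, 'w, 'a) path \<Rightarrow> nat \<Rightarrow> nat \<Rightarrow> ('ag, 'w, 'a) history" where
  "segment l j k = History (map (pstates l) [j..<Suc k]) (map (pacts l) [j..<k])"

definition histories :: "('ag, 'p, 'w, 'a) game_structure \<Rightarrow> ('ag, 'w, 'a) history set" where
  "histories M = {segment l j k | l j k. l \<in> paths M \<and> j \<le> k}"

definition hlen :: "('ag, 'w, 'a) history \<Rightarrow> nat" where
  "hlen h = length (hacts h)"

definition hlast :: "('ag, 'w, 'a) history \<Rightarrow> 'w" where
  "hlast h = last (hstates h)"

definition hist_indist ::
    "('ag, 'p, 'w, 'a) game_structure \<Rightarrow> 'ag \<Rightarrow>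
     ('ag, 'w, 'a) history \<Rightarrow> ('ag, 'w, 'a) history \<Rightarrow> bool" where
  "hist_indist M i h h' \<longleftrightarrow>
     hlen h = hlen h' \<and>
     (\<forall>j\<le>hlen h. (hstates h ! j, hstates h' ! j) \<in> indist M i) \<and>
     (\<forall>l<hlen h. (hacts h ! l) i = (hacts h' ! l) i)"

definition group_indist ::
    "('ag, 'p, 'w, 'a) game_structure \<Rightarrow> 'ag set \<Rightarrow>
     ('ag, 'w, 'a) history \<Rightarrow> ('ag, 'w, 'a) history \<Rightarrow> bool" where
  "group_indist M G h h' \<longleftrightarrow> (\<forall>i\<in>G. hist_indist M i h h')"

definition path_class ::
    "('ag, 'p, 'w, 'a) game_structure \<Rightarrow> 'ag set \<Rightarrow> nat \<Rightarrow> ('ag, 'w, 'a) path \<Rightarrow>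
     ('ag, 'w, 'a) path set" where
  "path_class M G j l = {l' \<in> paths M. group_indist M G (segment l 0 j) (segment l' 0 j)}"

text \<open>Strategies have the set of histories of \<open>M\<close> as their domain, so their values on other
  elements of the history type are left unconstrained; the same holds for the components of
  a joint strategy at agents outside the coalition.\<close>

definition strategy ::
    "('ag, 'p, 'w, 'a) game_structure \<Rightarrow> 'ag set \<Rightarrow> 'ag \<Rightarrow>
     (('ag, 'w, 'a) history \<Rightarrow> 'a) \<Rightarrow> bool" where
  "strategy M G i f \<longleftrightarrow>
     (\<forall>h\<in>histories M. f h \<in> avail M i (hlast h)) \<and>
     (\<forall>h\<in>histories M. \<forall>h'\<in>histories M. group_indist M G h h' \<longrightarrow> f h = f h')"

definition joint_strategy ::
    "('ag, 'p, 'w, 'a) game_structure \<Rightarrow> 'ag set \<Rightarrow>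
     ('ag \<Rightarrow> ('ag, 'w, 'a) history \<Rightarrow> 'a) \<Rightarrow> bool" where
  "joint_strategy M G F \<longleftrightarrow> (\<forall>i\<in>G. strategy M G i (F i))"

definition outcomes ::
    "('ag, 'p, 'w, 'a) game_structure \<Rightarrow> ('ag, 'w, 'a) history \<Rightarrow> 'ag \<Rightarrow>
     (('ag, 'w, 'a) history \<Rightarrow> 'a) \<Rightarrow> ('ag, 'w, 'a) path set" where
  "outcomes M h i f =
     {l \<in> paths M. segment l 0 (hlen h) = h \<and>
                   (\<forall>j\<ge>hlen h. f (segment l 0 j) = pacts l j i)}"

definition joint_outcomes ::
    "('ag, 'p, 'w, 'a) game_structure \<Rightarrow> ('ag, 'w, 'a) history \<Rightarrow> 'ag set \<Rightarrow>
     ('ag \<Rightarrow> ('ag, 'w, 'a) history \<Rightarrow> 'a) \<Rightarrow> ('ag, 'w, 'a) path set" where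
  "joint_outcomes M h G F = (\<Inter>i\<in>G. outcomes M h i (F i))"

primrec sat ::
    "('ag, 'p, 'w, 'a) game_structure \<Rightarrow> ('ag, 'w, 'a) path \<Rightarrow> nat \<Rightarrow>
     ('ag, 'p) formula \<Rightarrow> bool" where
  "sat M l j (Atom p) \<longleftrightarrow> pstates l j \<in> val M p"
| "sat M l j (Neg \<phi>) \<longleftrightarrow> \<not> sat M l j \<phi>"
| "sat M l j (Conj \<phi> \<psi>) \<longleftrightarrow> sat M l j \<phi> \<and> sat M l j \<psi>"
| "sat M l j (CNext G \<phi>) \<longleftrightarrow>
     (\<exists>F. joint_strategy M G F \<and>
        (\<forall>l'\<in>path_class M G j l. \<forall>l''\<in>joint_outcomes M (segment l' 0 j) G F.
           sat M l'' (j + 1) \<phi>))"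
| "sat M l j (CAlways G \<phi>) \<longleftrightarrow>
     (\<exists>F. joint_strategy M G F \<and>
        (\<forall>l'\<in>path_class M G j l. \<forall>l''\<in>joint_outcomes M (segment l' 0 j) G F.
           \<forall>k\<ge>j. sat M l'' k \<phi>))"
| "sat M l j (CUntil G \<phi> \<psi>) \<longleftrightarrow>
     (\<exists>F. joint_strategy M G F \<and>
        (\<forall>l'\<in>path_class M G j l. \<forall>l''\<in>joint_outcomes M (segment l' 0 j) G F.
           \<exists>k\<ge>j. sat M l'' k \<psi> \<and> (\<forall>t. j \<le> t \<and> t < k \<longrightarrow> sat M l'' t \<phi>)))"

text \<open>HOL cannot quantify over types inside a formula, so the types \<open>'w\<close> and \<open>'a\<close> from which the
  states and actions of the models are drawn appear as parameters of validity. Being valid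
  means being \<open>valid\<close> for all choices of these types.\<close>

definition valid :: "'w itself \<Rightarrow> 'a itself \<Rightarrow> ('ag, 'p) formula \<Rightarrow> bool" where
  "valid W A \<phi> \<longleftrightarrow>
     (\<forall>(M :: ('ag, 'p, 'w, 'a) game_structure) l j.
        icgs M \<longrightarrow> l \<in> paths M \<longrightarrow> sat M l j \<phi>)"

end

theory Submission imports Defs begin

text \<open>Truth of a formula at stage \<open>j\<close> depends only on the path up to \<open>j\<close>, and every history can be
  prolonged to a path that follows a given joint strategy. Hence \<open>D\<^sub>G \<phi>\<close> holds iff \<open>\<phi>\<close> holds on the
  whole \<open>G\<close>-indistinguishability class, i.e. \<open>D\<^sub>G\<close> is distributed knowledge. Items 2, 4 and 6 follow
  because coalition formulas are evaluated on that class, and item 5 because knowledge is factive.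
  For items 1 and 3, a path \<open>m\<close> indistinguishable at stage \<open>k\<close> from an outcome of a strategy
  has, by uniformity and since agents recall their own actions, followed that strategy up to
  \<open>k\<close>; prolonging its history at \<open>k\<close> gives an outcome which agrees with \<open>m\<close> up to \<open>k\<close>.\<close>

section \<open>Histories as path segments, and indistinguishability\<close>

lemma segment_eq_iff:
  "segment l 0 n = segment l' 0 n \<longleftrightarrow>
     (\<forall>t\<le>n. pstates l t = pstates l' t) \<and> (\<forall>t<n. pacts l t = pacts l' t)"
  by (auto simp: segment_def simp del: upt_Suc)

lemma hlen_segment [simp]: "hlen (segment l 0 n) = n"
  by (simp add: segment_def hlen_def)

lemma hlast_segment [simp]: "hlast (segment l 0 n) = pstates l n"
  by (simp add: segment_def hlast_def)

text \<open>Membership in \<open>histories M\<close> matters: an arbitrary term of the history type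
  may carry state and action lists of unrelated lengths.\<close>

lemma hlast_eq_nth: "h \<in> histories M \<Longrightarrow> hlast h = hstates h ! hlen h"
  by (auto simp: histories_def segment_def hlast_def hlen_def nth_append)

lemma segment_in_histories: "l \<in> paths M \<Longrightarrow> segment l 0 n \<in> histories M"
  by (auto simp: histories_def)

lemma group_indist_segment:
  "group_indist M G (segment l 0 n) (segment l' 0 n) \<longleftrightarrow>
     (\<forall>i\<in>G. (\<forall>t\<le>n. (pstates l t, pstates l' t) \<in> indist M i) \<and>
             (\<forall>t<n. pacts l t i = pacts l' t i))"
  by (simp add: group_indist_def hist_indist_def) (simp add: segment_def nth_append del: upt_Suc)

lemma indist_equivD:
  assumes "icgs M"
  shows "equiv (states M) (indist M i)"
  using assms by (auto simp: icgs_def)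

lemma group_indist_mono:
  "group_indist M G (segment l 0 n) (segment l' 0 n) \<Longrightarrow> m \<le> n \<Longrightarrow>
   group_indist M G (segment l 0 m) (segment l' 0 m)"
  by (auto simp: group_indist_segment)

lemma path_class_refl:
  assumes "icgs M" "l \<in> paths M"
  shows "l \<in> path_class M G j l"
  using assms indist_equivD[OF assms(1)]
  by (auto simp: path_class_def group_indist_segment paths_def equiv_def refl_on_def)

lemma group_indist_sym:
  assumes "icgs M" "group_indist M G (segment l 0 n) (segment l' 0 n)"
  shows "group_indist M G (segment l' 0 n) (segment l 0 n)"
  using assms(2) indist_equivD[OF assms(1)]
  unfolding group_indist_segment equiv_def by (metis symD)

lemma group_indist_trans:
  assumes "icgs M" "group_indist M G (segment l 0 n) (segment l' 0 n)"
    "group_indist M G (segment l' 0 n) (segment l'' 0 n)"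
  shows "group_indist M G (segment l 0 n) (segment l'' 0 n)"
proof -
  have "Relation.trans (indist M i)" for i
    using indist_equivD[OF assms(1)] by (simp add: equiv_def)
  then show ?thesis
    using assms(2,3) unfolding group_indist_segment by (metis transD)
qed

lemma path_class_eq:
  assumes "icgs M" "l' \<in> path_class M G j l"
  shows "path_class M G j l' = path_class M G j l"
  using assms group_indist_sym[OF assms(1)] group_indist_trans[OF assms(1)]
  unfolding path_class_def by blast

text \<open>An atom reads only the state at \<open>j\<close>, and a coalition operator sees the path
  only through \<open>path_class\<close>, which is determined by the segment. Induction hypotheses
  are thus needed only for the Boolean connectives.\<close>

lemma sat_segment_cong:
  assumes "segment l 0 j = segment l' 0 j"
  shows "sat M l j \<phi> \<longleftrightarrow> sat M l' j \<phi>"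
proof -
  have "path_class M G j l = path_class M G j l'" for G
    by (simp add: path_class_def assms)
  moreover have "pstates l j = pstates l' j"
    using assms by (simp add: segment_eq_iff)
  ultimately show ?thesis by (induction \<phi>) simp_all
qed

section \<open>Joint strategies and existence of their outcomes\<close>

lemma joint_outcomes_iff:
  assumes "G \<noteq> {}"
  shows "l \<in> joint_outcomes M (segment l' 0 j) G F \<longleftrightarrow>
     l \<in> paths M \<and> segment l 0 j = segment l' 0 j \<and>
     (\<forall>i\<in>G. \<forall>k\<ge>j. F i (segment l 0 k) = pacts l k i)"
  using assms by (auto simp: joint_outcomes_def outcomes_def)

lemma joint_outcomes_paths: "G \<noteq> {} \<Longrightarrow> joint_outcomes M h G F \<subseteq> paths M"
  by (auto simp: joint_outcomes_def outcomes_def)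

lemma joint_strategy_exists:
  fixes M :: "('ag, 'p, 'w, 'a) game_structure"
  assumes M: "icgs M"
  shows "\<exists>F. joint_strategy M G F"
proof -
  \<comment> \<open>The choice depends on \<open>h\<close> only through the set of available
    actions. That set is the same at indistinguishable states, so the choice is uniform.\<close>
  define F where "F i h = (SOME a. a \<in> avail M i (hlast h))" for i and h :: "('ag, 'w, 'a) history"
  have "hlast h \<in> states M" if "h \<in> histories M" for h
    using that by (auto simp: histories_def segment_def hlast_def paths_def)
  then have "F i h \<in> avail M i (hlast h)" if "h \<in> histories M" for h i
    using that M unfolding F_def icgs_def by (metis some_in_eq)
  moreover have "F i h = F i h'"
    if "h \<in> histories M" "h' \<in> histories M" "group_indist M G h h'" "i \<in> G" for h h' i
  proof -
    have "(hlast h, hlast h') \<in> indist M i"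
      using that by (auto simp: group_indist_def hist_indist_def hlast_eq_nth)
    then have "avail M i (hlast h) = avail M i (hlast h')"
      using M by (auto simp: icgs_def)
    then show ?thesis by (simp add: F_def)
  qed
  ultimately have "joint_strategy M G F"
    by (auto simp: joint_strategy_def strategy_def)
  then show ?thesis by blast
qed

lemma path_from_state:
  assumes M: "icgs M" and w: "w \<in> states M"
  shows "\<exists>q\<in>paths M. pstates q 0 = w"
proof -
  define \<alpha> where "\<alpha> v i = (SOME a. a \<in> avail M i v)" for v i
  have \<alpha>: "\<alpha> v \<in> joint_avail M v" if "v \<in> states M" for v
    using that M unfolding \<alpha>_def icgs_def joint_avail_def by (simp add: some_in_eq)
  define s where "s n = ((\<lambda>v. trans M v (\<alpha> v)) ^^ n) w" for n
  have "s n \<in> states M" for n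
    using M w \<alpha> by (induction n) (auto simp: s_def icgs_def)
  then have "Path s (\<lambda>n. \<alpha> (s n)) \<in> paths M"
    using \<alpha> by (simp add: paths_def) (simp add: s_def)
  moreover have "s 0 = w" by (simp add: s_def)
  ultimately show ?thesis by force
qed

text \<open>Any available joint action can replace the one taken at stage \<open>k\<close>, and the
  result extends to a full path. This is one step in building an outcome.\<close>

lemma path_redirect:
  assumes M: "icgs M" and l: "l \<in> paths M" and \<alpha>: "\<alpha> \<in> joint_avail M (pstates l k)"
  shows "\<exists>l'\<in>paths M. segment l' 0 k = segment l 0 k \<and> pacts l' k = \<alpha>"
proof -
  have l1: "pstates l t \<in> states M" "pacts l t \<in> joint_avail M (pstates l t)"
    "trans M (pstates l t) (pacts l t) = pstates l (Suc t)" for t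
    using l by (auto simp: paths_def)
  have "trans M (pstates l k) \<alpha> \<in> states M"
    using M \<alpha> l1 by (auto simp: icgs_def)
  then obtain q where q: "q \<in> paths M" "pstates q 0 = trans M (pstates l k) \<alpha>"
    using path_from_state[OF M] by blast
  have q1: "pstates q t \<in> states M" "pacts q t \<in> joint_avail M (pstates q t)"
    "trans M (pstates q t) (pacts q t) = pstates q (Suc t)" for t
    using q by (auto simp: paths_def)
  \<comment> \<open>Follow \<open>l\<close> up to its state at \<open>k\<close>, play \<alpha>, then
    follow \<open>q\<close> delayed by \<open>k + 1\<close> stages.\<close>
  define l' where "l' = Path (\<lambda>t. if t \<le> k then pstates l t else pstates q (t - Suc k))
     (\<lambda>t. if t < k then pacts l t else if t = k then \<alpha> else pacts q (t - Suc k))"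
  have "pstates q (Suc (t - Suc k)) = pstates q (t - k)" if "k < t" for t
    using that by (simp add: Suc_diff_Suc)
  then have "l' \<in> paths M"
    using l1 q1 q(2) \<alpha> by (auto simp: paths_def l'_def not_less_eq_eq dest!: le_antisym)
  moreover have "segment l' 0 k = segment l 0 k" "pacts l' k = \<alpha>"
    by (auto simp: segment_eq_iff l'_def)
  ultimately show ?thesis by blast
qed

text \<open>Starting from \<open>l\<close>, redirect the path at one stage after another so that
  \<open>G\<close> plays \<open>F\<close> from \<open>j\<close> on. Stage \<open>n\<close> leaves
  the history up to \<open>n\<close> intact, so the successive paths have a limit, which is the
  outcome.\<close>

lemma joint_outcomes_nonempty:
  assumes M: "icgs M" and G: "G \<noteq> {}" and l: "l \<in> paths M" and F: "joint_strategy M G F"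
  shows "\<exists>l'. l' \<in> joint_outcomes M (segment l 0 j) G F"
proof -
  have step: "\<exists>m'\<in>paths M. segment m' 0 n = segment m 0 n \<and>
      (if n < j then m' = m else (\<forall>i\<in>G. pacts m' n i = F i (segment m 0 n)))"
    if m: "m \<in> paths M" for m n
  proof (cases "n < j")
    case False
    \<comment> \<open>Agents outside \<open>G\<close> keep their action on \<open>m\<close>.\<close>
    define \<alpha> where "\<alpha> i = (if i \<in> G then F i (segment m 0 n) else pacts m n i)" for i
    have "F i (segment m 0 n) \<in> avail M i (pstates m n)" if "i \<in> G" for i
      using F that segment_in_histories[OF m, of n] hlast_segment
      unfolding joint_strategy_def strategy_def by metis
    moreover have "pacts m n i \<in> avail M i (pstates m n)" for i
      using m by (auto simp: paths_def joint_avail_def)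
    ultimately have "\<alpha> \<in> joint_avail M (pstates m n)"
      by (simp add: joint_avail_def \<alpha>_def)
    from path_redirect[OF M m this] obtain m' where
      "m' \<in> paths M" "segment m' 0 n = segment m 0 n" "pacts m' n = \<alpha>" by blast
    with False show ?thesis by (intro bexI[of _ m']) (simp_all add: \<alpha>_def)
  qed (use m in auto)
  define Q where "Q n m m' \<longleftrightarrow> segment m' 0 n = segment m 0 n \<and>
      (if n < j then m' = m else (\<forall>i\<in>G. pacts m' n i = F i (segment m 0 n)))" for n m m'
  have "\<exists>p. \<forall>n. (p n \<in> paths M \<and> (n = 0 \<longrightarrow> p n = l)) \<and> Q n (p n) (p (Suc n))"
  proof (rule dependent_nat_choice)
    show "\<exists>m. m \<in> paths M \<and> (0 = 0 \<longrightarrow> m = l)" using l by blast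
    show "\<exists>m'. (m' \<in> paths M \<and> (Suc n = 0 \<longrightarrow> m' = l)) \<and> Q n m m'"
      if "m \<in> paths M \<and> (n = 0 \<longrightarrow> m = l)" for m n
      using step[of m n] that unfolding Q_def by blast
  qed
  then obtain p where p: "\<And>n. p n \<in> paths M" "p 0 = l"
    and agree: "\<And>n. segment (p (Suc n)) 0 n = segment (p n) 0 n"
    and before: "\<And>n. n < j \<Longrightarrow> p (Suc n) = p n"
    and after: "\<And>n i. j \<le> n \<Longrightarrow> i \<in> G \<Longrightarrow> pacts (p (Suc n)) n i = F i (segment (p n) 0 n)"
    unfolding Q_def by (metis not_le)
  have agree': "segment (p m) 0 n = segment (p n) 0 n" if "n \<le> m" for m n
    using that
  proof (induction m rule: dec_induct)
    case (step m)
    then have "segment (p (Suc m)) 0 n = segment (p m) 0 n"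
      using agree[of m] by (auto simp: segment_eq_iff)
    with step.IH show ?case by simp
  qed simp
  \<comment> \<open>The diagonal limit. The state at \<open>t\<close> is settled from
    \<open>p t\<close> on, but the action at \<open>t\<close> only from \<open>p (Suc t)\<close>,
    since that path is the one redirected at stage \<open>t\<close>.\<close>
  define L where "L = Path (\<lambda>t. pstates (p t) t) (\<lambda>t. pacts (p (Suc t)) t)"
  have L_seg: "segment L 0 n = segment (p n) 0 n" for n
  proof -
    have "pstates (p t) t = pstates (p n) t" if "t \<le> n" for t
      using agree'[OF that] by (simp add: segment_eq_iff)
    moreover have "pacts (p (Suc t)) t = pacts (p n) t" if "t < n" for t
      using agree'[of "Suc t" n] that by (simp add: segment_eq_iff)
    ultimately show ?thesis by (simp add: segment_eq_iff L_def)
  qed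
  \<comment> \<open>Each transition of \<open>L\<close> is read off a single path,
    \<open>p (Suc t)\<close>.\<close>
  have "pstates L t = pstates (p (Suc t)) t" "pstates L (Suc t) = pstates (p (Suc t)) (Suc t)"
    "pacts L t = pacts (p (Suc t)) t" for t
    using L_seg[of "Suc t"] by (simp_all add: segment_eq_iff)
  then have "L \<in> paths M" using p(1) by (auto simp: paths_def)
  moreover have "segment L 0 j = segment l 0 j"
  proof -
    have "n \<le> j \<Longrightarrow> p n = l" for n
      by (induction n) (simp_all add: p before)
    then show ?thesis by (simp add: L_seg)
  qed
  moreover have "\<forall>i\<in>G. \<forall>k\<ge>j. F i (segment L 0 k) = pacts L k i"
    using after by (simp add: L_seg) (simp add: L_def)
  ultimately show ?thesis using joint_outcomes_iff[OF G] by blast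
qed

section \<open>The operator \<open>DK\<close> as distributed knowledge\<close>

lemma sat_DK_iff:
  assumes M: "icgs M" and G: "G \<noteq> {}"
  shows "sat M l j (DK G \<phi>) \<longleftrightarrow> (\<forall>l'\<in>path_class M G j l. sat M l' j \<phi>)"
proof
  assume "sat M l j (DK G \<phi>)"
  then obtain F where F: "joint_strategy M G F"
    and until: "\<And>l' l''. l' \<in> path_class M G j l \<Longrightarrow> l'' \<in> joint_outcomes M (segment l' 0 j) G F \<Longrightarrow>
      \<exists>k\<ge>j. sat M l'' k \<phi> \<and> (\<forall>t. j \<le> t \<and> t < k \<longrightarrow> sat M l'' t \<phi>)"
    by auto
  show "\<forall>l'\<in>path_class M G j l. sat M l' j \<phi>"
  proof
    fix l' assume l': "l' \<in> path_class M G j l"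
    then have "l' \<in> paths M" by (simp add: path_class_def)
    then obtain l'' where l'': "l'' \<in> joint_outcomes M (segment l' 0 j) G F"
      using joint_outcomes_nonempty[OF M G _ F] by blast
    \<comment> \<open>If the witness is \<open>k = j\<close>, the goal of the until gives this; if
      \<open>j < k\<close>, its left argument does, at \<open>t = j\<close>.\<close>
    have "sat M l'' j \<phi>"
      using until[OF l' l''] by (metis le_refl nat_less_le)
    moreover have "segment l'' 0 j = segment l' 0 j"
      using l'' by (simp add: joint_outcomes_iff[OF G])
    ultimately show "sat M l' j \<phi>" using sat_segment_cong by blast
  qed
next
  assume *: "\<forall>l'\<in>path_class M G j l. sat M l' j \<phi>"
  obtain F where F: "joint_strategy M G F"
    using joint_strategy_exists[OF M] by blast
  have "sat M l'' j \<phi>"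
    if "l' \<in> path_class M G j l" "l'' \<in> joint_outcomes M (segment l' 0 j) G F" for l' l''
  proof -
    have "segment l'' 0 j = segment l' 0 j"
      using that(2) by (simp add: joint_outcomes_iff[OF G])
    from sat_segment_cong[OF this] show ?thesis using * that(1) by blast
  qed
  \<comment> \<open>Any joint strategy serves, because the until is already fulfilled at
    \<open>k = j\<close>.\<close>
  with F show "sat M l j (DK G \<phi>)"
    by (simp, intro exI[of _ F]) (auto intro!: exI[of _ j])
qed

lemma sat_DK_imp:
  assumes "icgs M" "G \<noteq> {}" "l \<in> paths M" "sat M l j (DK G \<phi>)"
  shows "sat M l j \<phi>"
  using assms path_class_refl sat_DK_iff by blast

lemma sat_DK_invariant:
  assumes "icgs M" "G \<noteq> {}" "l \<in> paths M"
    and "\<And>l'. path_class M G j l' = path_class M G j l \<Longrightarrow> sat M l' j \<phi> \<longleftrightarrow> sat M l j \<phi>"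
  shows "sat M l j (DK G \<phi>) \<longleftrightarrow> sat M l j \<phi>"
  using assms path_class_refl path_class_eq sat_DK_iff by metis

text \<open>Stated for a single stage \<open>k\<close>, so that it serves both the next operator
  (\<open>k = j + 1\<close>) and the always operator (every \<open>k\<close> from \<open>j\<close>
  on).\<close>

lemma sat_DK_on_outcome:
  assumes M: "icgs M" and G: "G \<noteq> {}" and F: "joint_strategy M G F"
    and l': "l' \<in> path_class M G j l" and l'': "l'' \<in> joint_outcomes M (segment l' 0 j) G F"
    and "j \<le> k"
    and sat: "\<And>m m'. m \<in> path_class M G j l \<Longrightarrow> m' \<in> joint_outcomes M (segment m 0 j) G F \<Longrightarrow>
      sat M m' k \<phi>"
  shows "sat M l'' k (DK G \<phi>)"
  unfolding sat_DK_iff[OF M G]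
proof
  fix m assume m: "m \<in> path_class M G k l''"
  then have m_path: "m \<in> paths M" and ind: "group_indist M G (segment l'' 0 k) (segment m 0 k)"
    by (auto simp: path_class_def)
  have l''_path: "l'' \<in> paths M" and l''_seg: "segment l'' 0 j = segment l' 0 j"
    and l''_F: "\<And>i t. i \<in> G \<Longrightarrow> j \<le> t \<Longrightarrow> F i (segment l'' 0 t) = pacts l'' t i"
    using l'' by (auto simp: joint_outcomes_iff[OF G])
  have "group_indist M G (segment l 0 j) (segment l'' 0 j)"
    using l' l''_seg by (simp add: path_class_def)
  from group_indist_trans[OF M this group_indist_mono[OF ind \<open>j \<le> k\<close>]]
  have m_class: "m \<in> path_class M G j l"
    using m_path by (simp add: path_class_def)
  \<comment> \<open>Uniformity equates the prescriptions of \<open>F\<close> on \<open>l''\<close>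
    and \<open>m\<close>; recall of own actions equates the actions of \<open>G\<close> taken
    there.\<close>
  have m_F: "F i (segment m 0 t) = pacts m t i" if "i \<in> G" "j \<le> t" "t < k" for i t
  proof -
    have "group_indist M G (segment l'' 0 t) (segment m 0 t)"
      using group_indist_mono[OF ind] that by simp
    then have "F i (segment l'' 0 t) = F i (segment m 0 t)"
      using F \<open>i \<in> G\<close> segment_in_histories[OF m_path] segment_in_histories[OF l''_path]
      unfolding joint_strategy_def strategy_def by blast
    moreover have "pacts l'' t i = pacts m t i"
      using ind that by (simp add: group_indist_segment)
    ultimately show ?thesis using l''_F that by simp
  qed
  \<comment> \<open>From stage \<open>k\<close> on, \<open>m\<close> may deviate from
    \<open>F\<close>, so its continuation is replaced.\<close>
  obtain m' where m': "m' \<in> joint_outcomes M (segment m 0 k) G F"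
    using joint_outcomes_nonempty[OF M G m_path F] by blast
  then have m'_seg: "segment m' 0 k = segment m 0 k"
    by (simp add: joint_outcomes_iff[OF G])
  then have m'_seg_le: "segment m' 0 t = segment m 0 t" if "t \<le> k" for t
    using that by (simp add: segment_eq_iff)
  have "F i (segment m' 0 t) = pacts m' t i" if "i \<in> G" "j \<le> t" for i t
  proof (cases "t < k")
    case True
    then have "pacts m' t = pacts m t"
      using m'_seg by (simp add: segment_eq_iff)
    with True show ?thesis using m_F that m'_seg_le by simp
  qed (use m' that in \<open>simp add: joint_outcomes_iff[OF G]\<close>)
  then have "m' \<in> joint_outcomes M (segment m 0 j) G F"
    using m' m'_seg_le[OF \<open>j \<le> k\<close>] by (simp add: joint_outcomes_iff[OF G])
  then have "sat M m' k \<phi>"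
    using sat m_class by blast
  then show "sat M m k \<phi>"
    using sat_segment_cong[OF m'_seg] by blast
qed

section \<open>Knowledge inside the coalition operators\<close>

lemma sat_CNext_DK:
  assumes M: "icgs M" and G: "G \<noteq> {}"
  shows "sat M l j (CNext G (DK G \<phi>)) \<longleftrightarrow> sat M l j (CNext G \<phi>)"
proof
  assume "sat M l j (CNext G (DK G \<phi>))"
  then show "sat M l j (CNext G \<phi>)"
    using sat_DK_imp[OF M G] joint_outcomes_paths[OF G, of M] unfolding sat.simps(4) by (meson subsetD)
next
  assume "sat M l j (CNext G \<phi>)"
  then obtain F where F: "joint_strategy M G F"
    and "\<forall>l'\<in>path_class M G j l. \<forall>l''\<in>joint_outcomes M (segment l' 0 j) G F. sat M l'' (j + 1) \<phi>"
    unfolding sat.simps(4) by blast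
  then have "sat M l'' (j + 1) (DK G \<phi>)"
    if "l' \<in> path_class M G j l" "l'' \<in> joint_outcomes M (segment l' 0 j) G F" for l' l''
    by (intro sat_DK_on_outcome[OF M G F that]) auto
  with F show "sat M l j (CNext G (DK G \<phi>))"
    unfolding sat.simps(4) by blast
qed

lemma sat_CAlways_DK:
  assumes M: "icgs M" and G: "G \<noteq> {}"
  shows "sat M l j (CAlways G (DK G \<phi>)) \<longleftrightarrow> sat M l j (CAlways G \<phi>)"
proof
  assume "sat M l j (CAlways G (DK G \<phi>))"
  then show "sat M l j (CAlways G \<phi>)"
    using sat_DK_imp[OF M G] joint_outcomes_paths[OF G, of M] unfolding sat.simps(5) by (meson subsetD)
next
  assume "sat M l j (CAlways G \<phi>)"
  then obtain F where F: "joint_strategy M G F"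
    and "\<forall>l'\<in>path_class M G j l. \<forall>l''\<in>joint_outcomes M (segment l' 0 j) G F. \<forall>k\<ge>j. sat M l'' k \<phi>"
    unfolding sat.simps(5) by blast
  then have "sat M l'' k (DK G \<phi>)"
    if "l' \<in> path_class M G j l" "l'' \<in> joint_outcomes M (segment l' 0 j) G F" "j \<le> k" for l' l'' k
    by (intro sat_DK_on_outcome[OF M G F that]) (use that in auto)
  with F show "sat M l j (CAlways G (DK G \<phi>))"
    unfolding sat.simps(5) by blast
qed

text \<open>Factivity is applied stage by stage. \<open>sat_DK_on_outcome\<close> yields no converse
  here: the stage fulfilling the until may vary between indistinguishable outcomes.\<close>

lemma sat_CUntil_DK_imp:
  assumes M: "icgs M" and G: "G \<noteq> {}" and sat: "sat M l j (CUntil G (DK G \<phi>) (DK G \<psi>))"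
  shows "sat M l j (CUntil G \<phi> \<psi>)"
proof -
  obtain F where F: "joint_strategy M G F"
    and until: "\<forall>l'\<in>path_class M G j l. \<forall>l''\<in>joint_outcomes M (segment l' 0 j) G F.
      \<exists>k\<ge>j. sat M l'' k (DK G \<psi>) \<and> (\<forall>t. j \<le> t \<and> t < k \<longrightarrow> sat M l'' t (DK G \<phi>))"
    \<comment> \<open>The explicit instance unfolds only the outer until, since \<open>DK\<close> is
      itself a \<open>CUntil\<close>.\<close>
    using sat unfolding sat.simps(6)[of M l j G "DK G \<phi>" "DK G \<psi>"] by blast
  have "l'' \<in> paths M" if "l'' \<in> joint_outcomes M (segment l' 0 j) G F" for l' l''
    using that by (simp add: joint_outcomes_iff[OF G])
  then have "\<forall>l'\<in>path_class M G j l. \<forall>l''\<in>joint_outcomes M (segment l' 0 j) G F.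
      \<exists>k\<ge>j. sat M l'' k \<psi> \<and> (\<forall>t. j \<le> t \<and> t < k \<longrightarrow> sat M l'' t \<phi>)"
    using until sat_DK_imp[OF M G] by meson
  with F show ?thesis by auto
qed

theorem proposition3:
  fixes G :: "'ag::finite set" and \<phi> \<psi> :: "('ag, 'p::countable) formula"
  assumes "G \<noteq> {}" and "\<phi> \<in> language" and "\<psi> \<in> language"
  shows
    "valid TYPE('w) TYPE('a) (Iff (CNext G \<phi>) (CNext G (DK G \<phi>))) \<and>
     valid TYPE('w) TYPE('a) (Iff (CNext G \<phi>) (DK G (CNext G \<phi>))) \<and>
     valid TYPE('w) TYPE('a) (Iff (CAlways G \<phi>) (CAlways G (DK G \<phi>))) \<and>
     valid TYPE('w) TYPE('a) (Iff (CAlways G \<phi>) (DK G (CAlways G \<phi>))) \<and>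
     valid TYPE('w) TYPE('a) (Imp (CUntil G (DK G \<phi>) (DK G \<psi>)) (CUntil G \<phi> \<psi>)) \<and>
     valid TYPE('w) TYPE('a) (Iff (CUntil G \<phi> \<psi>) (DK G (CUntil G \<phi> \<psi>)))"
proof -
  have Imp: "valid TYPE('w) TYPE('a) (Imp \<alpha> \<beta>)"
    if "\<And>(M :: ('ag, 'p, 'w, 'a) game_structure) l j.
      icgs M \<Longrightarrow> l \<in> paths M \<Longrightarrow> sat M l j \<alpha> \<Longrightarrow> sat M l j \<beta>" for \<alpha> \<beta>
    using that by (simp add: valid_def)
  have Iff: "valid TYPE('w) TYPE('a) (Iff \<alpha> \<beta>)"
    if "\<And>(M :: ('ag, 'p, 'w, 'a) game_structure) l j.
      icgs M \<Longrightarrow> l \<in> paths M \<Longrightarrow> sat M l j \<beta> \<longleftrightarrow> sat M l j \<alpha>" for \<alpha> \<beta>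
    using that by (simp add: valid_def)
  \<comment> \<open>The premise holds for every formula headed by an operator of \<open>G\<close>:
    its semantics mentions the path only through \<open>path_class M G j l\<close>.\<close>
  have know: "valid TYPE('w) TYPE('a) (Iff \<alpha> (DK G \<alpha>))"
    if "\<And>(M :: ('ag, 'p, 'w, 'a) game_structure) l l' j.
      path_class M G j l' = path_class M G j l \<Longrightarrow> sat M l' j \<alpha> \<longleftrightarrow> sat M l j \<alpha>" for \<alpha>
    using sat_DK_invariant[OF _ assms(1) _ that] by (intro Iff)
  show ?thesis
  proof (intro conjI)
    show "valid TYPE('w) TYPE('a) (Iff (CNext G \<phi>) (CNext G (DK G \<phi>)))"
      by (intro Iff sat_CNext_DK assms(1))
    show "valid TYPE('w) TYPE('a) (Iff (CNext G \<phi>) (DK G (CNext G \<phi>)))"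
      by (rule know) simp
    show "valid TYPE('w) TYPE('a) (Iff (CAlways G \<phi>) (CAlways G (DK G \<phi>)))"
      by (intro Iff sat_CAlways_DK assms(1))
    show "valid TYPE('w) TYPE('a) (Iff (CAlways G \<phi>) (DK G (CAlways G \<phi>)))"
      by (rule know) simp
    show "valid TYPE('w) TYPE('a) (Imp (CUntil G (DK G \<phi>) (DK G \<psi>)) (CUntil G \<phi> \<psi>))"
      by (rule Imp) (rule sat_CUntil_DK_imp[OF _ assms(1)])
    show "valid TYPE('w) TYPE('a) (Iff (CUntil G \<phi> \<psi>) (DK G (CUntil G \<phi> \<psi>)))"
      by (rule know) simp
  qed
qed

end
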